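(* Let $\mathbb{T}=(T_{ij})$ be a $d \times d$ operator matrix where $T_{ij}\in \mathcal{B}_{A^{1/2}}(\mathcal{H})$ for all $i,j\in\{1,\dots,d\}$ and $T_{ij}=O$ when $i>j$ (i.e. $\mathbb{T}$ is upper triangular). Then $$\omega_{\mathbb{A}}(\mathbb{T})\geq \max \left \{ \omega_A(T_{kk}),\ \tfrac{1}{2}\|T_{ij}\|_A: 1\leq k\leq d,\ 1\leq i<j\leq d\right \}.$$
   Context: $\mathcal{H}$ is a complex Hilbert space with inner product $\langle\cdot\mid\cdot\rangle$ (linear in the first variable), and $A\in\mathcal{B}(\mathcal{H})$ is a nonzero positive (semi-definite) operator. For any positive operator $A$ on a Hilbert space, put $\langle x\mid y\rangle_A=\langle Ax\mid y\rangle$ and $\|x\|_A=\langle x\mid x\rangle_A^{1/2}$. $\mathcal{B}_{A^{1/2}}(\mathcal{H})$ is the set of $T\in\mathcal{B}(\mathcal{H})$ for which there is $\lambda>0$ with $\|Tx\|_A\le\lambda\|x\|_A$ for all $x\in\mathcal{H}$; for such $T$, $\|T\|_A=\sup\{\|Tx\|_A:\|x\|_A=1\}$ and $\omega_A(T)=\sup\{|\langle Tx\mid x\rangle_A| : \|x\|_A=1\}$. $\mathbb{H}=\oplus_{i=1}^d\mathcal{H}$ is the Hilbert space direct sum with $\langle x,y\rangle=\sum_{k=1}^d\langle x_k\mid y_k\rangle$, $\mathbb{A}=\mathrm{diag}(A,\dots,A)$ is the $d\times d$ diagonal operator matrix, a positive operator on $\mathbb{H}$, and $\omega_{\mathbb{A}}$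 is defined in the same way as $\omega_A$ with $(\mathbb{H},\mathbb{A})$ in place of $(\mathcal{H},A)$. *)

theory Defs
  imports "HOL-Analysis.Analysis"
begin

class complex_vector = real_vector +
  fixes scaleC :: "complex \<Rightarrow> 'a \<Rightarrow> 'a"  (infixr \<open>*\<^sub>C\<close> 75)
  assumes scaleC_add_right: "c *\<^sub>C (x + y) = c *\<^sub>C x + c *\<^sub>C y"
    and scaleC_add_left: "(c + d) *\<^sub>C x = c *\<^sub>C x + d *\<^sub>C x"
    and scaleC_scaleC: "c *\<^sub>C (d *\<^sub>C x) = (c * d) *\<^sub>C x"
    and scaleC_of_real: "complex_of_real r *\<^sub>C x = r *\<^sub>R x"

text \<open>The inner product is linear in the first and conjugate-linear in the second variable.
  Completeness is inherited from \<^class>\<open>banach\<close>.\<close>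

class complex_hilbert_space = complex_vector + banach +
  fixes cinner :: "'a \<Rightarrow> 'a \<Rightarrow> complex"
  assumes cinner_add_left: "cinner (x + y) z = cinner x z + cinner y z"
    and cinner_scaleC_left: "cinner (c *\<^sub>C x) y = c * cinner x y"
    and cinner_commute: "cinner y x = cnj (cinner x y)"
    and cinner_self_nonneg: "cinner x x \<in> \<real>\<^sub>\<ge>\<^sub>0"
    and norm_eq_sqrt_cinner: "norm x = sqrt (Re (cinner x x))"

text \<open>The Hilbert space direct sum of \<open>CARD('n)\<close> copies of a Hilbert space is carried by the
  vector type of HOL-Analysis, whose norm is already the \<open>\<ell>\<^sup>2\<close> norm of the component norms.\<close>

instantiation vec :: (complex_vector, finite) complex_vector
begin

definition scaleC_vec :: "complex \<Rightarrow> 'a ^ 'b \<Rightarrow> 'a ^ 'b"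
  where "scaleC_vec c x = (\<chi> i. c *\<^sub>C (x $ i))"

instance
  by standard
    (simp_all add: scaleC_vec_def vec_eq_iff scaleC_add_right scaleC_add_left scaleC_scaleC
      scaleC_of_real)

end

instantiation vec :: (complex_hilbert_space, finite) complex_hilbert_space
begin

definition cinner_vec :: "'a ^ 'b \<Rightarrow> 'a ^ 'b \<Rightarrow> complex"
  where "cinner_vec x y = (\<Sum>i\<in>UNIV. cinner (x $ i) (y $ i))"

instance
proof
  fix x y z :: "'a ^ 'b" and c :: complex
  show "cinner (x + y) z = cinner x z + cinner y z"
    by (simp add: cinner_vec_def cinner_add_left sum.distrib)
  show "cinner (c *\<^sub>C x) y = c * cinner x y"
    by (simp add: cinner_vec_def scaleC_vec_def cinner_scaleC_left sum_distrib_left)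
  show "cinner y x = cnj (cinner x y)"
    unfolding cinner_vec_def cnj_sum by (intro sum.cong refl cinner_commute)
  have nonneg: "Im (cinner u u) = 0" "0 \<le> Re (cinner u u)" for u :: 'a
    using cinner_self_nonneg[of u] by (auto simp: complex_nonneg_Reals_iff)
  show "cinner x x \<in> \<real>\<^sub>\<ge>\<^sub>0"
    by (simp add: cinner_vec_def complex_nonneg_Reals_iff nonneg sum_nonneg)
  show "norm x = sqrt (Re (cinner x x))"
    by (simp add: cinner_vec_def norm_vec_def L2_set_def norm_eq_sqrt_cinner nonneg)
qed

end

definition bounded_operator :: "('a::complex_hilbert_space \<Rightarrow> 'a) \<Rightarrow> bool"
  where "bounded_operator T \<longleftrightarrow> bounded_linear T \<and> (\<forall>c x. T (c *\<^sub>C x) = c *\<^sub>C T x)"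

definition positive_operator :: "('a::complex_hilbert_space \<Rightarrow> 'a) \<Rightarrow> bool"
  where "positive_operator A \<longleftrightarrow> bounded_operator A \<and> (\<forall>x. cinner (A x) x \<in> \<real>\<^sub>\<ge>\<^sub>0)"

definition A_inner :: "('a::complex_hilbert_space \<Rightarrow> 'a) \<Rightarrow> 'a \<Rightarrow> 'a \<Rightarrow> complex"
  where "A_inner A x y = cinner (A x) y"

definition A_seminorm :: "('a::complex_hilbert_space \<Rightarrow> 'a) \<Rightarrow> 'a \<Rightarrow> real"
  where "A_seminorm A x = sqrt (Re (A_inner A x x))"

definition A_bounded_operators :: "('a::complex_hilbert_space \<Rightarrow> 'a) \<Rightarrow> ('a \<Rightarrow> 'a) set"
  where "A_bounded_operators A =
    {T. bounded_operator T \<and> (\<exists>l>0. \<forall>x. A_seminorm A (T x) \<le> l * A_seminorm A x)}"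

text \<open>The suprema below are taken in the reals; they are meaningful when \<open>A\<close> is a nonzero
  positive operator (so that the set is nonempty) and \<open>T \<in> A_bounded_operators A\<close> (so that it
  is bounded above).\<close>

definition A_op_norm :: "('a::complex_hilbert_space \<Rightarrow> 'a) \<Rightarrow> ('a \<Rightarrow> 'a) \<Rightarrow> real"
  where "A_op_norm A T = Sup {A_seminorm A (T x) | x. A_seminorm A x = 1}"

definition A_numerical_radius :: "('a::complex_hilbert_space \<Rightarrow> 'a) \<Rightarrow> ('a \<Rightarrow> 'a) \<Rightarrow> real"
  where "A_numerical_radius A T = Sup {cmod (A_inner A (T x) x) | x. A_seminorm A x = 1}"

definition op_matrix :: "('n \<Rightarrow> 'n \<Rightarrow> 'a \<Rightarrow> 'a) \<Rightarrow> 'a::complex_hilbert_space ^ 'n \<Rightarrow> 'a ^ 'n"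
  where "op_matrix T x = (\<chi> i. \<Sum>j\<in>UNIV. T i j (x $ j))"

definition diag_op_matrix :: "('a \<Rightarrow> 'a) \<Rightarrow> 'a::complex_hilbert_space ^ 'n \<Rightarrow> 'a ^ 'n"
  where "diag_op_matrix A = op_matrix (\<lambda>i j. if i = j then A else (\<lambda>x. 0))"

end

theory Submission
  imports Defs
begin

text \<open>The set of values \<open>\<langle>\<T>u | u\<rangle>\<close> over unit vectors \<open>u\<close> contains the corresponding set for each
  \<open>T\<^sub>k\<^sub>k\<close>, since \<open>\<H>\<close> embeds as the \<open>k\<close>-th summand. For \<open>i < j\<close> let \<open>x\<close> and \<open>y\<close> be
  \<open>A\<close>-unit vectors. The vector \<open>u\<close> with entries \<open>x / \<surd>2\<close> at \<open>j\<close> and \<open>\<plusminus>y / \<surd>2\<close> at \<open>i\<close> is a unit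
  vector with \<open>2 \<langle>\<T>u | u\<rangle> = p \<plusminus> z\<close>, where \<open>p = \<langle>T\<^sub>i\<^sub>iy | y\<rangle> + \<langle>T\<^sub>j\<^sub>jx | x\<rangle>\<close> and
  \<open>z = \<langle>T\<^sub>i\<^sub>jx | y\<rangle>\<close>; the fourth term vanishes as \<open>\<T>\<close> is triangular. Hence \<open>\<bar>z\<bar> \<le> 2\<omega>(\<T>)\<close>,
  and choosing \<open>y\<close> proportional to \<open>T\<^sub>i\<^sub>jx\<close> gives \<open>\<parallel>T\<^sub>i\<^sub>jx\<parallel> \<le> 2\<omega>(\<T>)\<close>.\<close>

section \<open>Rules for the inner product and for bounded operators\<close>

lemma cinner_add_right: "cinner x (y + z) = cinner x y + cinner x z"
  for x y z :: "'a::complex_hilbert_space"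
  using arg_cong[OF cinner_add_left[of y z x], of cnj] by (simp flip: cinner_commute)

lemma cinner_scaleC_right: "cinner x (c *\<^sub>C y) = cnj c * cinner x y"
  for x y :: "'a::complex_hilbert_space"
  using arg_cong[OF cinner_scaleC_left[of c y x], of cnj] by (simp flip: cinner_commute)

lemma cinner_zero_left [simp]: "cinner 0 x = 0"
  for x :: "'a::complex_hilbert_space"
  using cinner_add_left[of 0 0 x] by simp

lemma cinner_zero_right [simp]: "cinner x 0 = 0"
  for x :: "'a::complex_hilbert_space"
  using cinner_add_right[of x 0 0] by simp

lemma cinner_sum_left: "cinner (sum f S) x = (\<Sum>i\<in>S. cinner (f i) x)"
  for x :: "'a::complex_hilbert_space"
  by (induction S rule: infinite_finite_induct) (simp_all add: cinner_add_left)

lemma bounded_operator_add: "bounded_operator T \<Longrightarrow> T (x + y) = T x + T y"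
  and bounded_operator_zero: "bounded_operator T \<Longrightarrow> T 0 = 0"
  and bounded_operator_sum: "bounded_operator T \<Longrightarrow> T (sum f S) = (\<Sum>i\<in>S. T (f i))"
  and bounded_operator_scaleC: "bounded_operator T \<Longrightarrow> T (c *\<^sub>C x) = c *\<^sub>C T x"
  unfolding bounded_operator_def
  by (auto simp: linear_add linear_0 linear_sum dest!: bounded_linear.linear)

lemma A_bounded_operatorsD:
  assumes "T \<in> A_bounded_operators A"
  shows "bounded_operator T" and "\<exists>l>0. \<forall>x. A_seminorm A (T x) \<le> l * A_seminorm A x"
  using assms by (auto simp: A_bounded_operators_def)

section \<open>The semi-inner product induced by a positive operator\<close>

context
  fixes A :: "'a::complex_hilbert_space \<Rightarrow> 'a"
  assumes pos: "positive_operator A"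
begin

lemma bounded_A: "bounded_operator A"
  using pos by (simp add: positive_operator_def)

lemma A_inner_add_left: "A_inner A (x + y) z = A_inner A x z + A_inner A y z"
  by (simp add: A_inner_def bounded_operator_add[OF bounded_A] cinner_add_left)

lemma A_inner_add_right: "A_inner A x (y + z) = A_inner A x y + A_inner A x z"
  by (simp add: A_inner_def cinner_add_right)

lemma A_inner_scaleC_left: "A_inner A (c *\<^sub>C x) y = c * A_inner A x y"
  by (simp add: A_inner_def bounded_operator_scaleC[OF bounded_A] cinner_scaleC_left)

lemma A_inner_scaleC_right: "A_inner A x (c *\<^sub>C y) = cnj c * A_inner A x y"
  by (simp add: A_inner_def cinner_scaleC_right)

lemmas A_inner_simps = A_inner_add_left A_inner_add_right A_inner_scaleC_left A_inner_scaleC_right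

lemma Im_A_inner_self [simp]: "Im (A_inner A x x) = 0"
  and Re_A_inner_self [simp]: "0 \<le> Re (A_inner A x x)"
  using pos by (auto simp: positive_operator_def A_inner_def complex_nonneg_Reals_iff)

text \<open>Polarization: the form is real on the diagonal, so the imaginary parts at
  \<open>x + y\<close> and \<open>x + \<i> *\<^sub>C y\<close> yield Hermitian symmetry.\<close>

lemma A_inner_commute: "A_inner A y x = cnj (A_inner A x y)"
  using Im_A_inner_self[of "x + y"] Im_A_inner_self[of "x + \<i> *\<^sub>C y"]
  by (auto simp: A_inner_simps complex_eq_iff)

lemma A_seminorm_nonneg [simp]: "0 \<le> A_seminorm A x"
  by (simp add: A_seminorm_def)

lemma A_inner_self: "A_inner A x x = complex_of_real ((A_seminorm A x)\<^sup>2)"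
  by (simp add: A_seminorm_def complex_eq_iff)

lemma A_seminorm_scaleC: "A_seminorm A (c *\<^sub>C x) = cmod c * A_seminorm A x"
proof -
  have "A_inner A (c *\<^sub>C x) (c *\<^sub>C x) = (c * cnj c) * A_inner A x x"
    by (simp add: A_inner_simps)
  then have "Re (A_inner A (c *\<^sub>C x) (c *\<^sub>C x)) = (cmod c)\<^sup>2 * Re (A_inner A x x)"
    by (simp add: complex_mult_cnj cmod_power2)
  then show ?thesis
    by (simp add: A_seminorm_def real_sqrt_mult)
qed

lemma A_Cauchy_Schwarz: "cmod (A_inner A x y) \<le> A_seminorm A x * A_seminorm A y"
proof -
  define z where "z = A_inner A x y"
  define p where "p = (A_seminorm A x)\<^sup>2"
  define q where "q = (A_seminorm A y)\<^sup>2"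
  have yx: "A_inner A y x = cnj z"
    by (simp add: z_def A_inner_commute[of y x])
  \<comment> \<open>Positivity of the form at \<open>x - t z y\<close>; the factor \<open>z\<close>
    in the coefficient makes the cross terms real.\<close>
  have ineq: "0 \<le> p - 2 * t * (cmod z)\<^sup>2 + t\<^sup>2 * (cmod z)\<^sup>2 * q" for t
  proof -
    define c where "c = - (complex_of_real t * z)"
    have "A_inner A (x + c *\<^sub>C y) (x + c *\<^sub>C y) = p + cnj c * z + c * cnj z + c * cnj c * q"
      by (simp add: A_inner_simps A_inner_self[of x] A_inner_self[of y] p_def q_def yx flip: z_def) (simp add: algebra_simps)
    also have "\<dots> = complex_of_real p - 2 * t * (z * cnj z) + t\<^sup>2 * (z * cnj z) * q"
      by (simp add: c_def algebra_simps power2_eq_square)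
    also have "\<dots> = complex_of_real (p - 2 * t * (cmod z)\<^sup>2 + t\<^sup>2 * (cmod z)\<^sup>2 * q)"
      by (simp add: complex_norm_square[symmetric])
    finally show ?thesis
      using Re_A_inner_self[of "x + c *\<^sub>C y"] by simp
  qed
  have "(cmod z)\<^sup>2 \<le> p * q"
  proof (cases "q = 0")
    case True
    have "z = 0"
    proof (rule ccontr)
      assume "z \<noteq> 0"
      \<comment> \<open>This value of \<open>t\<close> makes the left-over expression
        \<open>p - 2 * t * (cmod z)\<^sup>2\<close> equal to -1.\<close>
      then show False
        using ineq[of "(p + 1) / (2 * (cmod z)\<^sup>2)"] True by simp
    qed
    then show ?thesis
      using True by simp
  next
    case False
    then have "q > 0"
      by (simp add: q_def)
    \<comment> \<open>\<open>t = 1 / q\<close> minimizes the quadratic in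
      \<open>ineq\<close>.\<close>
    then show ?thesis
      using ineq[of "1 / q"] by (simp add: field_simps power2_eq_square)
  qed
  then show ?thesis
    unfolding p_def q_def z_def power_mult_distrib[symmetric]
    by (rule power2_le_imp_le) simp
qed

text \<open>Pairing \<open>x\<close> with \<open>A x\<close> in the form gives the squared norm of
  \<open>A x\<close>, so by Cauchy-Schwarz a vector of seminorm zero lies in the kernel of
  \<open>A\<close>. The suprema are thus taken over nonempty sets.\<close>

lemma A_unit_vector_exists:
  assumes "A \<noteq> (\<lambda>x. 0)"
  shows "\<exists>x. A_seminorm A x = 1"
proof -
  obtain x where x: "A x \<noteq> 0"
    using assms by auto
  have "A_seminorm A x \<noteq> 0"
  proof
    assume "A_seminorm A x = 0"
    then have "A_inner A x (A x) = 0"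
      using A_Cauchy_Schwarz[of x "A x"] by simp
    then have "norm (A x) = 0"
      by (simp add: A_inner_def norm_eq_sqrt_cinner)
    with x show False
      by simp
  qed
  then have "A_seminorm A (complex_of_real (1 / A_seminorm A x) *\<^sub>C x) = 1"
    by (simp add: A_seminorm_scaleC norm_divide del: of_real_divide)
  then show ?thesis ..
qed

section \<open>Operator matrices on the direct sum\<close>

lemma A_inner_diag: "A_inner (diag_op_matrix A) u v = (\<Sum>i\<in>UNIV. A_inner A (u $ i) (v $ i))"
proof -
  \<comment> \<open>With the application moved inside the conditional, the sum over \<open>j\<close>
    collapses to a single term.\<close>
  have "(if i = j then A else (\<lambda>x. 0)) (u $ j) = (if i = j then A (u $ j) else 0)" for i j
    by simp
  then show ?thesis
    by (simp add: A_inner_def diag_op_matrix_def op_matrix_def cinner_vec_def)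
qed

lemma A_seminorm_diag: "A_seminorm (diag_op_matrix A) u = sqrt (\<Sum>i\<in>UNIV. (A_seminorm A (u $ i))\<^sup>2)"
  by (simp add: A_seminorm_def A_inner_diag sum_nonneg)

lemma A_inner_op_matrix:
  "A_inner (diag_op_matrix A) (op_matrix T u) u =
    (\<Sum>i\<in>UNIV. \<Sum>j\<in>UNIV. A_inner A (T i j (u $ j)) (u $ i))"
  by (simp add: A_inner_diag op_matrix_def)
    (simp add: A_inner_def bounded_operator_sum[OF bounded_A] cinner_sum_left)

text \<open>Each component of a unit vector has seminorm at most 1, so by Cauchy-Schwarz the entry
  bounds \<open>l i j\<close> add up to a bound. This lets values at unit vectors be compared with
  the real \<open>Sup\<close>.\<close>

lemma numerical_range_op_matrix_bdd_above:
  assumes T: "\<And>i j. T i j \<in> A_bounded_operators A"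
  shows "bdd_above {cmod (A_inner (diag_op_matrix A) (op_matrix T u) u) | u.
    A_seminorm (diag_op_matrix A) u = 1}"
proof -
  obtain l where l: "\<And>i j. l i j > 0"
      "\<And>i j x. A_seminorm A (T i j x) \<le> l i j * A_seminorm A x"
    using A_bounded_operatorsD(2)[OF T] by metis
  have "cmod (A_inner (diag_op_matrix A) (op_matrix T u) u) \<le> (\<Sum>i\<in>UNIV. \<Sum>j\<in>UNIV. l i j)"
    if u: "A_seminorm (diag_op_matrix A) u = 1" for u
  proof -
    have le1: "A_seminorm A (u $ i) \<le> 1" for i
    proof -
      have "(A_seminorm A (u $ i))\<^sup>2 \<le> (\<Sum>i\<in>UNIV. (A_seminorm A (u $ i))\<^sup>2)"
        by (rule member_le_sum) auto
      also have "\<dots> = 1"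
        using A_seminorm_diag[of u] u by simp
      finally show ?thesis
        by (simp add: power_le_one_iff)
    qed
    have "cmod (A_inner A (T i j (u $ j)) (u $ i)) \<le> l i j" for i j
    proof -
      have "cmod (A_inner A (T i j (u $ j)) (u $ i))
          \<le> A_seminorm A (T i j (u $ j)) * A_seminorm A (u $ i)"
        by (rule A_Cauchy_Schwarz)
      also have "\<dots> \<le> (l i j * 1) * 1"
        using l(1)[of i j] le1
        by (intro mult_mono order.trans[OF l(2)] mult_left_mono) auto
      finally show ?thesis
        by simp
    qed
    then show ?thesis
      unfolding A_inner_op_matrix
      by (intro order.trans[OF norm_sum] sum_mono)
  qed
  then show ?thesis
    by (intro bdd_aboveI) blast
qed

lemma numerical_radius_op_matrix_ge:
  assumes "\<And>i j. T i j \<in> A_bounded_operators A"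
    and "A_seminorm (diag_op_matrix A) u = 1"
  shows "cmod (A_inner (diag_op_matrix A) (op_matrix T u) u)
    \<le> A_numerical_radius (diag_op_matrix A) (op_matrix T)"
  unfolding A_numerical_radius_def
  using assms by (intro cSup_upper numerical_range_op_matrix_bdd_above) auto

lemma A_inner_zero [simp]: "A_inner A 0 x = 0" "A_inner A x 0 = 0"
  by (simp_all add: A_inner_def bounded_operator_zero[OF bounded_A])

lemma A_seminorm_zero [simp]: "A_seminorm A 0 = 0"
  by (simp add: A_seminorm_def)

section \<open>Diagonal entries\<close>

lemma numerical_radius_diagonal_le:
  assumes A0: "A \<noteq> (\<lambda>x. 0)"
    and T: "\<And>i j. T i j \<in> A_bounded_operators A"
  shows "A_numerical_radius A (T k k) \<le> A_numerical_radius (diag_op_matrix A) (op_matrix T)"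
  unfolding A_numerical_radius_def[of A]
proof (rule cSup_least)
  show "{cmod (A_inner A (T k k x) x) |x. A_seminorm A x = 1} \<noteq> {}"
    using A_unit_vector_exists[OF A0] by auto
  fix r assume "r \<in> {cmod (A_inner A (T k k x) x) |x. A_seminorm A x = 1}"
  then obtain x where x: "A_seminorm A x = 1" and r: "r = cmod (A_inner A (T k k x) x)"
    by auto
  define u where "u = (\<chi> i. if i = k then x else 0)"
  have T0: "T i j 0 = 0" for i j
    by (rule bounded_operator_zero[OF A_bounded_operatorsD(1)[OF T]])
  have "(\<Sum>i\<in>UNIV. (A_seminorm A (u $ i))\<^sup>2) = (\<Sum>i\<in>UNIV. if i = k then 1 else 0)"
    by (intro sum.cong) (simp_all add: u_def x)
  then have "A_seminorm (diag_op_matrix A) u = 1"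
    by (simp add: A_seminorm_diag)
  moreover have "A_inner (diag_op_matrix A) (op_matrix T u) u =
      (\<Sum>i\<in>UNIV. \<Sum>j\<in>UNIV. if j = k then if i = k then A_inner A (T k k x) x else 0 else 0)"
    unfolding A_inner_op_matrix by (intro sum.cong refl) (auto simp: u_def T0)
  then have "A_inner (diag_op_matrix A) (op_matrix T u) u = A_inner A (T k k x) x"
    by simp
  ultimately show "r \<le> A_numerical_radius (diag_op_matrix A) (op_matrix T)"
    using numerical_radius_op_matrix_ge[where T = T and u = u, OF T] by (simp add: r)
qed

section \<open>Entries off the diagonal\<close>

lemma A_inner_off_diagonal_le:
  assumes T: "\<And>i j. T i j \<in> A_bounded_operators A"
    and ij: "i \<noteq> j" and Tji: "T j i = (\<lambda>x. 0)"
    and x: "A_seminorm A x = 1" and y: "A_seminorm A y = 1"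
  shows "cmod (A_inner A (T i j x) y)
    \<le> 2 * A_numerical_radius (diag_op_matrix A) (op_matrix T)"
proof -
  define w where "w = A_numerical_radius (diag_op_matrix A) (op_matrix T)"
  define s where "s = complex_of_real (1 / sqrt 2)"
  have "s * s = 1/2"
    unfolding s_def of_real_mult[symmetric] by simp
  then have s: "cnj s = s" "s * s = 1/2" "cmod s = 1 / sqrt 2"
    by (simp_all add: s_def norm_divide)
  have scale: "T k l (c *\<^sub>C v) = c *\<^sub>C T k l v" and T0: "T k l 0 = 0" for k l c v
    by (simp_all add: bounded_operator_scaleC bounded_operator_zero A_bounded_operatorsD(1)[OF T])
  define p where "p = A_inner A (T i i y) y + A_inner A (T j j x) x"
  define z where "z = A_inner A (T i j x) y"
  have bound: "cmod (p + of_real e * z) \<le> 2 * w" if e: "e = 1 \<or> e = -1" for e :: real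
  proof -
    \<comment> \<open>The sign sits on the coefficient of \<open>y\<close> alone: it changes the
      cross term, while \<open>e * e = 1\<close> leaves both diagonal terms as they are.\<close>
    define c where "c = complex_of_real e * s"
    have c: "cnj c = c" "c * c = 1/2" "s * c = of_real e / 2" "cmod c = 1 / sqrt 2"
      using e s by (auto simp: c_def norm_mult simp flip: mult.assoc)
    define u where "u = (\<chi> k. if k = i then c *\<^sub>C y else if k = j then s *\<^sub>C x else 0)"
    have u [simp]: "u $ i = c *\<^sub>C y" "u $ j = s *\<^sub>C x" "k \<noteq> i \<Longrightarrow> k \<noteq> j \<Longrightarrow> u $ k = 0" for k
      using ij by (simp_all add: u_def)
    \<comment> \<open>The vector \<open>u\<close> is supported on two coordinates. The value type is
      left general, since both real and complex sums are reduced this way.\<close>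
    have reduce: "sum f UNIV = f i + f j" if "\<And>k. k \<noteq> i \<Longrightarrow> k \<noteq> j \<Longrightarrow> f k = 0"
      for f :: "_ \<Rightarrow> 'c::comm_monoid_add"
    proof -
      have "sum f UNIV = sum f {i, j}"
        using that by (intro sum.mono_neutral_right) auto
      then show ?thesis
        using ij by simp
    qed
    have "A_seminorm (diag_op_matrix A) u = 1"
      unfolding A_seminorm_diag
      by (subst reduce) (simp_all add: A_seminorm_scaleC x y s c power_divide)
    then have "cmod (A_inner (diag_op_matrix A) (op_matrix T u) u) \<le> w"
      unfolding w_def by (rule numerical_radius_op_matrix_ge[OF T])
    also have "A_inner (diag_op_matrix A) (op_matrix T u) u
        = (c * c) * A_inner A (T i i y) y + (s * c) * z + (s * s) * A_inner A (T j j x) x"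
    proof -
      have inner: "(\<Sum>l\<in>UNIV. A_inner A (T k l (u $ l)) (u $ k))
          = A_inner A (T k i (u $ i)) (u $ k) + A_inner A (T k j (u $ j)) (u $ k)" for k
        by (rule reduce) (simp add: T0)
      show ?thesis
        unfolding A_inner_op_matrix inner
        by (subst reduce) (simp_all add: A_inner_simps scale Tji s(1) c(1) z_def ac_simps)
    qed
    also have "\<dots> = (p + of_real e * z) / 2"
      unfolding c s p_def by (simp add: field_simps)
    finally show ?thesis
      by (simp add: norm_divide)
  qed
  \<comment> \<open>Subtracting the expressions for the two signs cancels the diagonal contribution
    \<open>p\<close>.\<close>
  have "2 * cmod z = cmod ((p + z) - (p - z))"
    by (simp add: norm_mult flip: mult_2)
  also have "\<dots> \<le> cmod (p + z) + cmod (p - z)"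
    by (rule norm_triangle_ineq4)
  also have "\<dots> \<le> 4 * w"
    using bound[of 1] bound[of "-1"] by simp
  finally show ?thesis
    by (simp add: z_def w_def)
qed

lemma op_norm_off_diagonal_le:
  assumes A0: "A \<noteq> (\<lambda>x. 0)"
    and T: "\<And>i j. T i j \<in> A_bounded_operators A"
    and ij: "i \<noteq> j" and Tji: "T j i = (\<lambda>x. 0)"
  shows "A_op_norm A (T i j) \<le> 2 * A_numerical_radius (diag_op_matrix A) (op_matrix T)"
  unfolding A_op_norm_def
proof (rule cSup_least)
  show "{A_seminorm A (T i j x) |x. A_seminorm A x = 1} \<noteq> {}"
    using A_unit_vector_exists[OF A0] by auto
  fix r assume "r \<in> {A_seminorm A (T i j x) |x. A_seminorm A x = 1}"
  then obtain x where x: "A_seminorm A x = 1" and r: "r = A_seminorm A (T i j x)"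
    by auto
  note bound = A_inner_off_diagonal_le[where T = T, OF T ij Tji x]
  show "r \<le> 2 * A_numerical_radius (diag_op_matrix A) (op_matrix T)"
  proof (cases "r = 0")
    \<comment> \<open>Normalization is impossible here; the bound with \<open>y = x\<close> shows
      that the right-hand side is nonnegative.\<close>
    case True
    then show ?thesis
      using order.trans[OF norm_ge_zero bound[OF x]] by simp
  next
    case False
    \<comment> \<open>The normalized image of \<open>x\<close> attains equality in Cauchy-Schwarz,
      so the pairing recovers \<open>r\<close>.\<close>
    define y where "y = complex_of_real (1 / r) *\<^sub>C T i j x"
    have "r > 0"
      using False r A_seminorm_nonneg[of "T i j x"] by linarith
    then have "A_seminorm A y = 1"
      by (simp add: y_def A_seminorm_scaleC norm_divide flip: r)
    moreover have "A_inner A (T i j x) y = complex_of_real r"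
      using False
      by (simp add: y_def A_inner_simps A_inner_self power2_eq_square flip: r)
    ultimately show ?thesis
      using bound[of y] \<open>r > 0\<close> by simp
  qed
qed

end

theorem theorem3p14:
  fixes A :: "'a::complex_hilbert_space \<Rightarrow> 'a"
    and T :: "'d::{finite,linorder} \<Rightarrow> 'd \<Rightarrow> 'a \<Rightarrow> 'a"
  assumes "positive_operator A"
    and "A \<noteq> (\<lambda>x. 0)"
    and "\<And>i j. T i j \<in> A_bounded_operators A"
    and "\<And>i j. i > j \<Longrightarrow> T i j = (\<lambda>x. 0)"
  shows "A_numerical_radius (diag_op_matrix A) (op_matrix T) \<ge>
    Max ({A_numerical_radius A (T k k) | k. True} \<union> {1/2 * A_op_norm A (T i j) | i j. i < j})"
proof (rule Max.boundedI)
  \<comment> \<open>\<open>Max\<close> calls for a finite set; each of the finitely many index pairs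
    contributes one value.\<close>
  have "{1/2 * A_op_norm A (T i j) | i j. i < j} \<subseteq> (\<Union>i j. {1/2 * A_op_norm A (T i j)})"
    by blast
  then have "finite {1/2 * A_op_norm A (T i j) | i j. i < j}"
    by (rule finite_subset) simp
  then show "finite ({A_numerical_radius A (T k k) | k. True} \<union>
      {1/2 * A_op_norm A (T i j) | i j. i < j})"
    by (simp add: full_SetCompr_eq)
  show "{A_numerical_radius A (T k k) | k. True} \<union> {1/2 * A_op_norm A (T i j) | i j. i < j} \<noteq> {}"
    by auto
next
  fix r
  assume "r \<in> {A_numerical_radius A (T k k) | k. True} \<union> {1/2 * A_op_norm A (T i j) | i j. i < j}"
  then consider k where "r = A_numerical_radius A (T k k)"
    | i j where "i < j" "r = 1/2 * A_op_norm A (T i j)"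
    by auto
  then show "r \<le> A_numerical_radius (diag_op_matrix A) (op_matrix T)"
  proof cases
    case 1
    then show ?thesis
      using numerical_radius_diagonal_le[where T = T, OF assms(1-3)] by simp
  next
    case (2 i j)
    then show ?thesis
      using op_norm_off_diagonal_le[where T = T,
          OF assms(1-3) less_imp_neq[OF 2(1)] assms(4)[OF 2(1)]]
      by simp
  qed
qed

end
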